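(* Let $n\ge 1$ and let $G$ be a multigraph on the node set $[n]=\{1,\dots,n\}$ with $n$ edges, where each edge is obtained independently by drawing an ordered pair $(u,v)$ uniformly from $[n]^2$ and taking the edge $\{u,v\}$ (self-loops and multi-edges are allowed). Then the probability that $G$ is a pseudotree is at least $(e/2)^{-n}\sqrt{\pi/(2n)}$.
   Context: A pseudotree is a connected (multi)graph that is either a tree or consists of a single cycle with trees branching from it; equivalently, a connected multigraph with at most as many edges as nodes (a self-loop or a pair of parallel edges counts as a cycle). *)

theory Defs
  imports "HOL-Probability.Probability"
begin

text \<open>
  An undirected multigraph: edges are labels, and an edge \<open>e\<close> joins \<open>u\<close> and \<open>v\<close> if its set of
  end points is \<open>{u, v}\<close>.  Distinct labels may have equal end points, and a self-loop has a
  singleton as its set of end points.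
\<close>

record ('v, 'e) multigraph =
  mverts :: "'v set"
  medges :: "'e set"
  mends :: "'e \<Rightarrow> 'v set"

definition mg_adj :: "('v, 'e) multigraph \<Rightarrow> ('v \<times> 'v) set" where
  "mg_adj G = {(u, v). \<exists>e\<in>medges G. mends G e = {u, v}}"

definition mg_connected :: "('v, 'e) multigraph \<Rightarrow> bool" where
  "mg_connected G \<longleftrightarrow> mverts G \<noteq> {} \<and> (\<forall>u\<in>mverts G. \<forall>v\<in>mverts G. (u, v) \<in> (mg_adj G)\<^sup>*)"

text \<open>
  A cycle is identified with its set of edges, so that the choice of a starting point and of an
  orientation does not count.  For \<open>k = 1\<close> it is a self-loop, and for \<open>k = 2\<close> a pair of parallel
  edges (the edges \<open>es\<close> must be distinct, not only the nodes \<open>vs\<close>).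
\<close>

definition mg_cycle :: "('v, 'e) multigraph \<Rightarrow> 'e set \<Rightarrow> bool" where
  "mg_cycle G C \<longleftrightarrow> C \<subseteq> medges G \<and>
     (\<exists>k vs es. k \<ge> 1 \<and> length vs = k \<and> length es = k \<and> distinct vs \<and> distinct es \<and> set es = C \<and>
        (\<forall>j<k. mends G (es ! j) = {vs ! j, vs ! (Suc j mod k)}))"

definition mg_tree :: "('v, 'e) multigraph \<Rightarrow> bool" where
  "mg_tree G \<longleftrightarrow> mg_connected G \<and> (\<nexists>C. mg_cycle G C)"

text \<open>
  A single cycle with trees branching from it is a connected multigraph with exactly one cycle.
\<close>

definition pseudotree :: "('v, 'e) multigraph \<Rightarrow> bool" where
  "pseudotree G \<longleftrightarrow> mg_tree G \<or> (mg_connected G \<and> (\<exists>!C. mg_cycle G C))"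

definition multigraph_of_pairs :: "nat \<Rightarrow> (nat \<Rightarrow> nat \<times> nat) \<Rightarrow> (nat, nat) multigraph" where
  "multigraph_of_pairs n \<omega> =
     \<lparr>mverts = {1..n}, medges = {1..n}, mends = (\<lambda>i. {fst (\<omega> i), snd (\<omega> i)})\<rparr>"

text \<open>
  \<^const>\<open>Pi_pmf\<close> makes the draws for the labels \<open>1, \<dots>, n\<close> independent; the default value
  \<open>(0, 0)\<close> is only taken outside this range of labels.
\<close>

definition random_multigraph :: "nat \<Rightarrow> (nat, nat) multigraph pmf" where
  "random_multigraph n =
     map_pmf (multigraph_of_pairs n)
       (Pi_pmf {1..n} (0, 0) (\<lambda>_. pmf_of_set ({1..n} \<times> {1..n})))"

end

theory Submission
  imports Defs "HOL-Real_Asymp.Real_Asymp"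
begin

text \<open>
  It suffices to count the draws that form a spanning tree together with one loop, placed at a node
  \<open>r\<close>. Orient the tree towards \<open>r\<close> and build it by inserting labelled edges from a child to its
  parent: to a forest with \<open>k\<close> edges one can add a new label by choosing any parent \<open>p\<close> and, as the
  child, any root other than the root of the tree of \<open>p\<close>, which is \<open>n (n - 1 - k)\<close> choices (Pitman).
  With \<open>n\<close> choices for the label of the loop and \<open>2\<^sup>n\<^sup>-\<^sup>1\<close> ways to order the ends of the tree edges,
  this gives at least \<open>n! n\<^sup>n\<^sup>-\<^sup>1 2\<^sup>n\<^sup>-\<^sup>1\<close> of the \<open>n\<^sup>2\<^sup>n\<close> draws. The claimed bound then is
  precisely Stirling's inequality \<open>n! \<ge> sqrt (2 pi n) (n / e)\<^sup>n\<close>.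
\<close>

section \<open>Rooted forests with labelled edges\<close>

text \<open>The pair \<open>f e = (c, p)\<close> says that \<open>p\<close> is the parent of \<open>c\<close>.\<close>

definition forests :: "'v set \<Rightarrow> 'e set \<Rightarrow> ('e \<Rightarrow> 'v \<times> 'v) set" where
  "forests V E = {f \<in> E \<rightarrow>\<^sub>E V \<times> V. inj_on (fst \<circ> f) E \<and> acyclic (f ` E)}"

lemma finite_forests: "finite V \<Longrightarrow> finite E \<Longrightarrow> finite (forests V E)"
  unfolding forests_def by (rule finite_subset[of _ "E \<rightarrow>\<^sub>E V \<times> V"]) (auto intro: finite_PiE)

lemma forests_in_verts:
  assumes "f \<in> forests V E" "e \<in> E"
  shows "fst (f e) \<in> V" "snd (f e) \<in> V"
  using assms by (auto simp: forests_def PiE_iff mem_Times_iff)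

lemma forests_fst_inj:
  "f \<in> forests V E \<Longrightarrow> e \<in> E \<Longrightarrow> e' \<in> E \<Longrightarrow> fst (f e) = fst (f e') \<Longrightarrow> e = e'"
  by (auto simp: forests_def inj_on_def)

lemma forests_not_loop:
  assumes "f \<in> forests V E" "e \<in> E"
  shows "fst (f e) \<noteq> snd (f e)"
proof
  assume "fst (f e) = snd (f e)"
  then have "(fst (f e), fst (f e)) \<in> f ` E"
    using assms(2) by (metis image_eqI prod.collapse)
  then show False
    using assms(1) unfolding forests_def acyclic_def by blast
qed

lemma forests_single_valued:
  assumes "f \<in> forests V E"
  shows "single_valued (f ` E)"
proof (rule single_valuedI)
  fix x y z assume "(x, y) \<in> f ` E" "(x, z) \<in> f ` E"
  then obtain e e' where e: "e \<in> E" "f e = (x, y)" and e': "e' \<in> E" "f e' = (x, z)"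
    by (metis imageE)
  then have "e = e'"
    using forests_fst_inj[OF assms] by simp
  then show "y = z"
    using e e' by simp
qed

text \<open>Induction along this relation reaches a node after its parent, so it runs from the roots
  outward.\<close>

lemma forests_wf_parent:
  assumes "f \<in> forests V E" "finite E"
  shows "wf ((f ` E)\<inverse>)"
  using assms by (intro finite_acyclic_wf_converse) (auto simp: forests_def)

lemma forests_insert:
  assumes f: "f \<in> forests V E" and e: "e \<notin> E"
    and c: "c \<in> V" "c \<notin> (fst \<circ> f) ` E" and p: "p \<in> V" "(p, c) \<notin> (f ` E)\<^sup>*"
  shows "f(e := (c, p)) \<in> forests V (insert e E)"
proof -
  have "(f(e := (c, p))) ` insert e E = insert (c, p) (f ` E)"
    using e by auto
  moreover have "inj_on (fst \<circ> f(e := (c, p))) (insert e E)"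
    using f e c unfolding forests_def inj_on_def by auto
  ultimately show ?thesis
    using f e c p unfolding forests_def by (auto simp: PiE_iff extensional_def)
qed

text \<open>Each edge removes only its child from the roots, so at least
  \<open>card V - card E\<close> roots remain. Climbing from \<open>p\<close> is deterministic,
  hence ends in at most one root, and only that one is forbidden.\<close>

lemma card_joinable_ge:
  assumes f: "f \<in> forests V E" and V: "finite V" and E: "finite E"
  shows "card {c \<in> V - (fst \<circ> f) ` E. (p, c) \<notin> (f ` E)\<^sup>*} \<ge> card V - 1 - card E"
proof -
  let ?R = "V - (fst \<circ> f) ` E"
  let ?T = "{c \<in> ?R. (p, c) \<in> (f ` E)\<^sup>*}"
  have "card ?T \<le> Suc 0"
  proof (subst card_le_Suc0_iff_eq)
    \<comment> \<open>A root has no parent, so it reaches only itself. Of two roots reachable from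
      \<open>p\<close>, one reaches the other because parents are unique, so they coincide.\<close>
    have end_eq: "c = d" if "(c, d) \<in> (f ` E)\<^sup>*" "c \<in> ?R" for c d
      using that(1)
    proof (cases rule: converse_rtranclE)
      case (step b)
      then obtain e where "e \<in> E" "(c, b) = f e"
        by blast
      then have "c \<in> (fst \<circ> f) ` E"
        by (intro image_eqI[of _ _ e]) (simp_all flip: \<open>(c, b) = f e\<close>)
      then show ?thesis
        using that(2) by blast
    qed
    show "\<forall>c\<in>?T. \<forall>d\<in>?T. c = d"
      using single_valued_confluent[OF forests_single_valued[OF f], of p] end_eq by blast
  qed (use V in auto)
  moreover have "card ?R \<ge> card V - card ((fst \<circ> f) ` E)"
    using E by (intro diff_card_le_card_Diff) auto
  moreover have "card ((fst \<circ> f) ` E) \<le> card E"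
    using E by (rule card_image_le)
  moreover have "card {c \<in> ?R. (p, c) \<notin> (f ` E)\<^sup>*} = card ?R - card ?T"
    using V by (subst card_Diff_subset[symmetric]) (auto intro!: arg_cong[where f=card])
  ultimately show ?thesis
    by linarith
qed

text \<open>Labels are inserted in one fixed order. The last label shows which edge came last, so
  different choices give different forests.\<close>

lemma card_forests_ge:
  assumes "finite V" "finite E"
  shows "card (forests V E) \<ge> (\<Prod>j<card E. card V * (card V - 1 - j))"
  using assms(2)
proof (induction E rule: finite_induct)
  case empty
  have "(\<lambda>_. undefined) \<in> forests V ({} :: 'b set)"
    by (auto simp: forests_def acyclic_def)
  moreover have "finite (forests V ({} :: 'b set))"
    using assms(1) by (simp add: finite_forests)
  ultimately have "card (forests V ({} :: 'b set)) > 0"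
    using card_gt_0_iff by blast
  then show ?case
    by simp
next
  case (insert e E)
  let ?C = "\<lambda>f p. {c \<in> V - (fst \<circ> f) ` E. (p, c) \<notin> (f ` E)\<^sup>*}"
  let ?S = "Sigma (forests V E) (\<lambda>f. Sigma V (?C f))"
  let ?h = "\<lambda>(f, p, c). f(e := (c, p))"
  have "inj_on ?h ?S"
  proof (rule inj_onI)
    fix s t assume s: "s \<in> ?S" and t: "t \<in> ?S" and eq: "?h s = ?h t"
    obtain f p c where s': "s = (f, p, c)" by (metis prod_cases3)
    obtain g q d where t': "t = (g, q, d)" by (metis prod_cases3)
    have E: "f \<in> extensional E" "g \<in> extensional E"
      using s t s' t' by (auto simp: forests_def PiE_def)
    have upd: "f(e := (c, p)) = g(e := (d, q))"
      using eq s' t' by simp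
    \<comment> \<open>At \<open>e\<close> both functions have the value \<open>undefined\<close> of
      extensional functions, so overwriting it loses nothing.\<close>
    have "f x = g x" for x
    proof (cases "x = e")
      case True
      then show ?thesis
        using E insert.hyps(2) by (metis extensional_arb)
    next
      case False
      then show ?thesis
        using upd by (metis fun_upd_other)
    qed
    then show "s = t"
      using fun_cong[OF upd, of e] s' t' by auto
  qed
  moreover have "?h ` ?S \<subseteq> forests V (insert e E)"
    using forests_insert[OF _ insert.hyps(2)] by (auto simp del: fun_upd_apply)
  ultimately have le: "card ?S \<le> card (forests V (insert e E))"
    using assms(1) insert.hyps(1) by (intro card_inj_on_le) (auto intro!: finite_forests)
  have "(\<Prod>j<card (insert e E). card V * (card V - 1 - j)) =
      (\<Prod>j<card E. card V * (card V - 1 - j)) * (card V * (card V - 1 - card E))"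
    using insert.hyps by simp
  also have "\<dots> \<le> card (forests V E) * (card V * (card V - 1 - card E))"
    using insert.IH by (rule mult_right_mono) simp
  also have "\<dots> = (\<Sum>f\<in>forests V E. \<Sum>p\<in>V. card V - 1 - card E)"
    by simp
  also have "\<dots> \<le> (\<Sum>f\<in>forests V E. \<Sum>p\<in>V. card (?C f p))"
    using assms(1) insert.hyps(1) by (intro sum_mono card_joinable_ge)
  also have "\<dots> = card ?S"
    using assms(1) insert.hyps(1) by (simp add: card_SigmaI finite_forests)
  finally show ?case
    using le by linarith
qed

text \<open>A forest with a single root is determined by its root and its undirected labelled edges: going
  away from the root, an edge whose parent end \<open>u\<close> has been treated cannot be reversed, since \<open>u\<close>
  already has another edge to its parent or is the root.\<close>

lemma forest_eqI:
  assumes f: "f \<in> forests V E" and g: "g \<in> forests V E" and E: "finite E"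
    and rf: "(fst \<circ> f) ` E = V - {r}" and rg: "(fst \<circ> g) ` E = V - {r}"
    and ends: "\<And>e. e \<in> E \<Longrightarrow> {fst (f e), snd (f e)} = {fst (g e), snd (g e)}"
  shows "f = g"
proof -
  have *: "\<forall>e\<in>E. fst (f e) = v \<longrightarrow> g e = f e" for v
  proof (induction v rule: wf_induct_rule[OF forests_wf_parent[OF f E]])
    case (1 v)
    show ?case
    proof (intro ballI impI)
      fix e assume e: "e \<in> E" "fst (f e) = v"
      define u where "u = snd (f e)"
      have fe: "f e = (v, u)"
        using e u_def by (metis prod.collapse)
      have "g e \<noteq> (u, v)"
      proof
        assume ge: "g e = (u, v)"
        then have "u \<in> V - {r}"
          using e(1) rg by (metis comp_apply fst_conv image_eqI)
        then obtain k where k: "k \<in> E" "fst (f k) = u"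
          using rf by (metis (no_types, lifting) comp_apply image_iff)
        have "(u, v) \<in> (f ` E)\<inverse>"
          using fe e(1) by (metis converse_iff image_eqI)
        then have "g k = f k"
          using 1 k by blast
        then have "k = e"
          using forests_fst_inj[OF g] k e(1) ge by simp
        then show False
          using k fe forests_not_loop[OF f e(1)] by simp
      qed
      then show "g e = f e"
        using ends[OF e(1)] fe by (cases "g e") (auto simp: doubleton_eq_iff)
    qed
  qed
  show ?thesis
  proof (rule extensionalityI)
    show "f \<in> extensional E" "g \<in> extensional E"
      using f g by (auto simp: forests_def PiE_def)
  qed (use * in auto)
qed

section \<open>A tree with a loop is a pseudotree\<close>

lemma connected_tree_with_loop:
  assumes f: "f \<in> forests V E" and E: "finite E" and r: "r \<in> V" "(fst \<circ> f) ` E = V - {r}"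
    and G: "mverts G = V" "E \<subseteq> medges G" "\<And>e. e \<in> E \<Longrightarrow> mends G e = {fst (f e), snd (f e)}"
  shows "mg_connected G"
proof -
  have adj: "(fst (f e), snd (f e)) \<in> mg_adj G" if "e \<in> E" for e
    using that G(2) G(3)[OF that] by (auto simp: mg_adj_def intro!: bexI[of _ e])
  have to_root: "v \<in> V \<longrightarrow> (v, r) \<in> (mg_adj G)\<^sup>*" for v
  proof (induction v rule: wf_induct_rule[OF forests_wf_parent[OF f E]])
    case (1 v)
    show ?case
    proof
      assume "v \<in> V"
      show "(v, r) \<in> (mg_adj G)\<^sup>*"
      proof (cases "v = r")
        case False
        then obtain e where e: "e \<in> E" "fst (f e) = v"
          using r(2) \<open>v \<in> V\<close> by (metis (no_types, lifting) DiffI comp_apply imageE singletonD)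
        have "(snd (f e), v) \<in> (f ` E)\<inverse>"
          using e by (metis converse_iff image_eqI prod.collapse)
        then have "(snd (f e), r) \<in> (mg_adj G)\<^sup>*"
          using 1 forests_in_verts[OF f e(1)] by blast
        then show ?thesis
          using adj[OF e(1)] e(2) by (metis converse_rtrancl_into_rtrancl)
      qed simp
    qed
  qed
  have "sym (mg_adj G)"
    by (auto simp: mg_adj_def sym_def insert_commute)
  then have "sym ((mg_adj G)\<^sup>*)"
    by (rule sym_rtrancl)
  then show ?thesis
    unfolding mg_connected_def G(1) using r(1) to_root by (blast intro: rtrancl_trans dest: symD)
qed

text \<open>Tree edges have two distinct ends, so a cycle of length 1 is the loop. A longer cycle
  avoids the loop and would lie in the forest.\<close>

lemma cycle_in_tree_with_loop:
  assumes f: "f \<in> forests V E" and E: "finite E" and r: "(fst \<circ> f) ` E = V - {r}"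
    and G: "medges G = insert i E" "\<And>e. e \<in> E \<Longrightarrow> mends G e = {fst (f e), snd (f e)}"
      "mends G i = {r}"
    and C: "mg_cycle G C"
  shows "C = {i}"
proof -
  obtain k vs es where k: "k \<ge> 1" "length vs = k" "length es = k" "distinct vs" "distinct es"
    and es: "set es = C" "\<And>j. j < k \<Longrightarrow> mends G (es ! j) = {vs ! j, vs ! (Suc j mod k)}"
    and sub: "C \<subseteq> insert i E"
    using C G(1) unfolding mg_cycle_def by blast
  show ?thesis
  proof (cases "k = 1")
    case True
    then obtain e where e: "es = [e]"
      using k(3) by (metis One_nat_def Suc_length_conv length_0_conv)
    obtain v where "mends G e = {v}"
      using es(2)[of 0] True e by auto
    then have "e \<notin> E"
      using G(2)[of e] forests_not_loop[OF f, of e] by (auto simp: doubleton_eq_iff)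
    then show ?thesis
      using e es(1) sub by auto
  next
    case False
    have two: "vs ! j \<noteq> vs ! (Suc j mod k)" if "j < k" for j
    proof -
      have "j \<noteq> Suc j mod k"
        using that False k(1) by (cases "Suc j = k") auto
      then show ?thesis
        using k that by (simp add: nth_eq_iff_index_eq)
    qed
    have inE: "e \<in> E" if e: "e \<in> C" for e
    proof -
      obtain j where j: "j < k" "e = es ! j"
        using e es(1) k(3) by (metis in_set_conv_nth)
      have "e \<noteq> i"
      proof
        assume "e = i"
        then have "{r} = {vs ! j, vs ! (Suc j mod k)}"
          using es(2)[OF j(1)] j(2) G(3) by metis
        then show False
          using two[OF j(1)] by (metis insertI1 insertI2 singletonD)
      qed
      then show ?thesis
        using that sub by auto
    qed
    have ends: "{fst (f e), snd (f e)} \<subseteq> set vs" if e: "e \<in> C" for e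
    proof -
      obtain j where j: "j < k" "e = es ! j"
        using e es(1) k(3) by (metis in_set_conv_nth)
      have "vs ! j \<in> set vs" "vs ! (Suc j mod k) \<in> set vs"
        using j k by auto
      then have "mends G e \<subseteq> set vs"
        using es(2)[OF j(1)] j(2) by auto
      then show ?thesis
        using G(2)[OF inE[OF that]] by auto
    qed
    \<comment> \<open>A cycle has as many nodes as edges, so each of its nodes is the child of one of its edges:
      its node set is closed under taking parents.\<close>
    have "inj_on (fst \<circ> f) C"
      using f inE unfolding forests_def inj_on_def by blast
    then have "card ((fst \<circ> f) ` C) = card (set vs)"
      using k es(1) by (metis card_image distinct_card)
    moreover have "(fst \<circ> f) ` C \<subseteq> set vs"
      using ends by auto
    ultimately have img: "(fst \<circ> f) ` C = set vs"
      by (simp add: card_subset_eq)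
    \<comment> \<open>A node set closed under parents is empty, since climbing in a finite forest
      must stop.\<close>
    have "v \<notin> set vs" for v
    proof (induction v rule: wf_induct_rule[OF forests_wf_parent[OF f E]])
      case (1 v)
      show ?case
      proof
        assume "v \<in> set vs"
        then obtain e where e: "e \<in> C" "fst (f e) = v"
          using img by (metis comp_apply imageE)
        have "(snd (f e), v) \<in> (f ` E)\<inverse>"
          using e inE by (metis converse_iff image_eqI prod.collapse)
        then show False
          using 1 ends[OF e(1)] by auto
      qed
    qed
    then show ?thesis
      using k(1,2) by (cases vs) auto
  qed
qed

lemma pseudotree_tree_with_loop:
  assumes f: "f \<in> forests V E" and E: "finite E" and r: "r \<in> V" "(fst \<circ> f) ` E = V - {r}"
    and G: "mverts G = V" "medges G = insert i E"
      "\<And>e. e \<in> E \<Longrightarrow> mends G e = {fst (f e), snd (f e)}" "mends G i = {r}"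
  shows "pseudotree G"
proof -
  have "\<forall>j<1. mends G ([i] ! j) = {[r] ! j, [r] ! (Suc j mod 1)}"
    using G(4) by simp
  moreover have "length [r] = 1" "length [i] = 1" "distinct [r]" "distinct [i]" "set [i] = {i}"
    by simp_all
  ultimately have "mg_cycle G {i}"
    unfolding mg_cycle_def using G(2) by blast
  then have "\<exists>!C. mg_cycle G C"
    using cycle_in_tree_with_loop[OF f E r(2) G(2-4)] by blast
  moreover have "mg_connected G"
    using connected_tree_with_loop[OF f E r G(1) _ G(3)] G(2) by blast
  ultimately show ?thesis
    by (simp add: pseudotree_def)
qed

section \<open>Stirling's lower bound for the factorial\<close>

text \<open>The logarithm of \<open>fact n / (sqrt n * (n / exp 1) ^ n)\<close>.\<close>

definition stirling_ratio :: "nat \<Rightarrow> real" where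
  "stirling_ratio n = ln (fact n) + n - (n + 1 / 2) * ln n"

lemma stirling_ratio_diff:
  assumes "n \<ge> 1"
  shows "stirling_ratio n - stirling_ratio (Suc n) = (n + 1 / 2) * (ln (real n + 1) - ln n) - 1"
proof -
  have "ln (fact (Suc n)) = ln (real n + 1) + ln (fact n)"
    by (simp add: ln_mult add.commute)
  then show ?thesis
    by (simp add: stirling_ratio_def algebra_simps)
qed

text \<open>By convexity of \<open>1 / x\<close>, its integral over \<open>[m, m + 1]\<close> is at
  least the midpoint value \<open>1 / (m + 1 / 2)\<close>.\<close>

lemma stirling_ratio_decreasing:
  assumes "1 \<le> n" "n \<le> m"
  shows "stirling_ratio m \<le> stirling_ratio n"
  using assms(2)
proof (induction m rule: dec_induct)
  case (step m)
  have m: "m \<ge> 1"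
    using step assms by simp
  have "1 = (m + 1 / 2) * (2 * (real m + 1 - m) / (m + (real m + 1)))"
    using m by (simp add: field_simps)
  also have "\<dots> \<le> (m + 1 / 2) * (ln (real m + 1) - ln m)"
    using m by (intro mult_left_mono ln_inverse_approx_ge) auto
  finally show ?case
    using stirling_ratio_diff[OF m] step.IH by linarith
qed simp

text \<open>The trapezoid rule bounds the same integral from above. The excess over 1 is
  \<open>1 / (4 * m * (m + 1))\<close>, which telescopes.\<close>

lemma stirling_ratio_increasing:
  assumes "1 \<le> n" "n \<le> m"
  shows "stirling_ratio n - 1 / (4 * real n) \<le> stirling_ratio m - 1 / (4 * real m)"
  using assms(2)
proof (induction m rule: dec_induct)
  case (step m)
  have m: "m \<ge> 1"
    using step assms by simp
  have "(m + 1 / 2) * (ln (real m + 1) - ln m) \<le>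
      (m + 1 / 2) * (1 * (inverse (real m) + inverse (real m + 1)) / 2)"
    using m by (intro mult_left_mono ln_inverse_approx_le) auto
  also have "\<dots> = 1 + 1 / (4 * m) - 1 / (4 * real (Suc m))"
    using m by (simp add: divide_simps) (simp add: algebra_simps)
  finally show ?case
    using stirling_ratio_diff[OF m] step.IH by linarith
qed simp

text \<open>The denominators factor as \<open>(2 * k - 1) * (2 * k + 1)\<close>, and the product of
  the odd numbers below \<open>2 * n\<close> is
  \<open>fact (2 * n) / (2 ^ n * fact n)\<close>.\<close>

lemma wallis_prod_fact:
  "(\<Prod>k=1..n. (4 * real k ^ 2) / (4 * real k ^ 2 - 1)) =
     (fact n ^ 4 * 16 ^ n) / (fact (2 * n) ^ 2 * (2 * real n + 1))"
proof (induction n)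
  case (Suc n)
  have "4 * (1 + real n)\<^sup>2 - 1 = (2 * real n + 1) * (2 * real n + 3)"
    by (simp add: power2_eq_square algebra_simps)
  then have "(\<Prod>k=1..Suc n. (4 * real k ^ 2) / (4 * real k ^ 2 - 1)) =
      (fact n ^ 4 * 16 ^ n) / (fact (2 * n) ^ 2 * (2 * real n + 1)) *
      (4 * (real n + 1) ^ 2 / ((2 * real n + 1) * (2 * real n + 3)))"
    using Suc by (simp add: add.commute)
  also have "\<dots> = (fact (Suc n) ^ 4 * 16 ^ Suc n) / 
     (((2 * real n + 2) * (2 * real n + 1) * fact (2 * n)) ^ 2 * (2 * real n + 3))"
  proof -
    have ne: "2 * real n + 1 \<noteq> 0" "2 * real n + 3 \<noteq> 0" "2 * real n + 2 \<noteq> 0" "fact (2 * n) \<noteq> (0::real)"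
      by (auto simp: add_eq_0_iff)
    \<comment> \<open>Here \<open>a\<close>, \<open>b\<close>, \<open>c\<close>, \<open>x\<close>
      stand for 2n+1, 2n+3, 2n+2, n+1. The point is
      \<open>4 * x ^ 2 = 16 * x ^ 4 / c ^ 2\<close>.\<close>
    have "a \<noteq> 0 \<Longrightarrow> b \<noteq> 0 \<Longrightarrow> c \<noteq> 0 \<Longrightarrow> F \<noteq> 0 \<Longrightarrow> c = 2 * x \<Longrightarrow>
      (g ^ 4 * s) / (F ^ 2 * a) * (4 * x ^ 2 / (a * b)) =
      ((x * g) ^ 4 * (16 * s)) / ((c * a * F) ^ 2 * b)" for a b c F x g s :: real
      by (simp add: field_simps power2_eq_square power4_eq_xxxx)
    from this[OF ne(1,2,3,4), of "real n + 1" "fact n" "16 ^ n"] show ?thesis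
      by (simp add: add.commute)
  qed
  also have "(2 * real n + 2) * (2 * real n + 1) * fact (2 * n) = fact (2 * Suc n)"
    by (simp add: algebra_simps)
  finally show ?case
    by (simp add: add.commute)
qed simp

text \<open>In this combination the terms in \<open>n\<close> and \<open>n * ln n\<close> cancel.
  The factor \<open>4 + 2 / n\<close> equals \<open>2 * (2 * n + 1) / n\<close> and absorbs the
  \<open>2 * n + 1\<close> of the Wallis product.\<close>

lemma stirling_ratio_wallis:
  assumes "n \<ge> 1"
  shows "4 * stirling_ratio n - 2 * stirling_ratio (2 * n) =
    ln ((\<Prod>k=1..n. (4 * real k ^ 2) / (4 * real k ^ 2 - 1)) * (4 + 2 / n))"
proof -
  have n: "real n > 0"
    using assms by simp
  have *: "4 + 2 / real n = 2 * (2 * real n + 1) / n"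
    using n by (simp add: field_simps)
  have "(fact n ^ 4 * 16 ^ n) / (fact (2 * n) ^ 2 * (2 * real n + 1)) * (4 + 2 / n) =
      (fact n ^ 4 * 2 ^ (4 * n) * 2) / (fact (2 * n) ^ 2 * real n)"
  proof -
    have "A / (F * b) * (2 * b / c) = A * 2 / (F * c)" if "b \<noteq> 0" for A F b c :: real
      using that by simp
    moreover have "2 * real n + 1 \<noteq> 0"
      using n by linarith
    moreover have "(2 :: real) ^ (4 * n) = 16 ^ n"
      by (simp add: power_mult)
    ultimately show ?thesis
      unfolding * by (simp only:)
  qed
  also have "ln \<dots> = 4 * ln (fact n) + (4 * n + 1) * ln 2 - 2 * ln (fact (2 * n)) - ln n"
    using n by (simp add: ln_div ln_mult ln_realpow algebra_simps)
  also have "\<dots> = 4 * stirling_ratio n - 2 * stirling_ratio (2 * n)"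
    using n by (simp add: stirling_ratio_def ln_mult algebra_simps)
  finally show ?thesis
    unfolding wallis_prod_fact by simp
qed

text \<open>For \<open>m \<ge> n\<close>, the two monotonicity lemmas bound half the Wallis
  logarithm at \<open>m\<close> by \<open>stirling_ratio n + 1 / (4 * m)\<close>. The Wallis product
  tends to \<open>pi / 2\<close>, so the limit gives the constant.\<close>

lemma stirling_ratio_ge:
  assumes "n \<ge> 1"
  shows "stirling_ratio n \<ge> ln (2 * pi) / 2"
proof (rule tendsto_upperbound)
  let ?W = "\<lambda>m. \<Prod>k=1..m. (4 * real k ^ 2) / (4 * real k ^ 2 - 1)"
  have "(\<lambda>m. 4 + 2 / real m) \<longlonglongrightarrow> 4 + 0" "(\<lambda>m. 1 / (4 * real m)) \<longlonglongrightarrow> 0"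
    by real_asymp+
  then have "(\<lambda>m. ln (?W m * (4 + 2 / m)) / 2 - 1 / (4 * real m)) \<longlonglongrightarrow>
      ln (pi / 2 * (4 + 0)) / 2 - 0"
    by (intro tendsto_intros wallis) auto
  then show "(\<lambda>m. ln (?W m * (4 + 2 / m)) / 2 - 1 / (4 * real m)) \<longlonglongrightarrow> ln (2 * pi) / 2"
    by (simp add: mult.commute)
  show "\<forall>\<^sub>F m in sequentially. ln (?W m * (4 + 2 / m)) / 2 - 1 / (4 * real m) \<le> stirling_ratio n"
    using eventually_ge_at_top[of n]
  proof eventually_elim
    case (elim m)
    have "stirling_ratio m - 1 / (4 * real m) \<le> stirling_ratio (2 * m) - 1 / (4 * real (2 * m))"
      using elim assms by (intro stirling_ratio_increasing) auto
    moreover have "1 / (4 * real (2 * m)) \<ge> 0"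
      by simp
    moreover have "stirling_ratio m \<le> stirling_ratio n"
      using elim assms by (intro stirling_ratio_decreasing) auto
    moreover have "ln (?W m * (4 + 2 / m)) = 4 * stirling_ratio m - 2 * stirling_ratio (2 * m)"
      using elim assms by (intro stirling_ratio_wallis[symmetric]) auto
    ultimately show ?case
      by argo
  qed
qed simp

lemma fact_ge_stirling:
  assumes "n \<ge> 1"
  shows "fact n \<ge> sqrt (2 * pi * n) * (n / exp 1) ^ n"
proof -
  have n: "real n > 0"
    using assms by simp
  have "ln (sqrt (2 * pi * n) * (n / exp 1) ^ n) = ln (2 * pi) / 2 + (n + 1 / 2) * ln n - n"
    using n by (simp add: ln_mult ln_sqrt ln_realpow ln_div algebra_simps)
  also have "\<dots> \<le> ln (fact n)"
    using stirling_ratio_ge[OF assms] by (simp add: stirling_ratio_def)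
  finally show ?thesis
    using n by (subst (asm) ln_le_cancel_iff) auto
qed

section \<open>Counting\<close>

definition forest_root :: "'v set \<Rightarrow> 'e set \<Rightarrow> ('e \<Rightarrow> 'v \<times> 'v) \<Rightarrow> 'v" where
  "forest_root V E f = the_elem (V - (fst \<circ> f) ` E)"

text \<open>The draw with a loop at label \<open>i\<close>, in which the edges with label in \<open>B\<close> are drawn from the
  parent to the child.\<close>

definition looped_draw ::
  "'v set \<Rightarrow> 'e set \<Rightarrow> 'v \<times> 'v \<Rightarrow> 'e \<times> ('e \<Rightarrow> 'v \<times> 'v) \<times> 'e set \<Rightarrow> 'e \<Rightarrow> 'v \<times> 'v" where
  "looped_draw V L d = (\<lambda>(i, f, B) e.
     if e \<notin> L then d
     else if e = i then (forest_root V (L - {i}) f, forest_root V (L - {i}) f)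
     else if e \<in> B then prod.swap (f e) else f e)"

lemma forest_root:
  assumes f: "f \<in> forests V E" and V: "finite V" "card V = Suc (card E)"
  shows "forest_root V E f \<in> V" "(fst \<circ> f) ` E = V - {forest_root V E f}"
proof -
  have img: "(fst \<circ> f) ` E \<subseteq> V"
    using forests_in_verts[OF f] by auto
  have "card ((fst \<circ> f) ` E) = card E"
    using f by (intro card_image) (auto simp: forests_def)
  then have "card (V - (fst \<circ> f) ` E) = 1"
    using V img by (subst card_Diff_subset) (auto intro: finite_subset)
  then obtain r where r: "V - (fst \<circ> f) ` E = {r}"
    by (auto simp: card_1_singleton_iff)
  then have "forest_root V E f = r"
    by (simp add: forest_root_def)
  then show "forest_root V E f \<in> V" "(fst \<circ> f) ` E = V - {forest_root V E f}"
    using r img by auto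
qed

text \<open>The label of the loop, the tree on the other labels, and the labels to be reversed. If
  \<open>card V = card L\<close>, the tree determines its root, so the node of the loop is not
  stored.\<close>

definition looped_trees :: "'v set \<Rightarrow> 'e set \<Rightarrow> ('e \<times> ('e \<Rightarrow> 'v \<times> 'v) \<times> 'e set) set" where
  "looped_trees V L = (SIGMA i:L. forests V (L - {i}) \<times> Pow (L - {i}))"

lemma card_looped_trees_ge:
  assumes "finite V" "finite L" "card V = n" "card L = n" "n \<ge> 1"
  shows "card (looped_trees V L) \<ge> fact n * n ^ (n - 1) * 2 ^ (n - 1)"
proof -
  have card_L: "card (L - {i}) = n - 1" if "i \<in> L" for i
    using that assms by simp
  \<comment> \<open>The order of the factors is reversed by \<open>j \<mapsto> n - 2 - j\<close>, an
    involution on the indices below \<open>n - 1\<close>.\<close>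
  have "(\<Prod>j<n - 1. n - 1 - j) = (\<Prod>j<n - 1. Suc j)"
    by (rule prod.reindex_bij_witness[of _ "\<lambda>j. n - 2 - j" "\<lambda>j. n - 2 - j"]) auto
  also have "\<dots> = fact (n - 1)"
    by (simp add: fact_prod_Suc atLeast0LessThan)
  finally have "(\<Prod>j<n - 1. n * (n - 1 - j)) = n ^ (n - 1) * fact (n - 1)"
    by (simp add: prod.distrib)
  then have forests_ge: "n ^ (n - 1) * fact (n - 1) \<le> card (forests V (L - {i}))" if "i \<in> L" for i
    using card_forests_ge[of V "L - {i}"] assms card_L[OF that] by simp
  have "fact n * n ^ (n - 1) * 2 ^ (n - 1) =
      (\<Sum>i\<in>L. n ^ (n - 1) * fact (n - 1) * 2 ^ (n - 1))"
    using assms by (simp add: fact_reduce)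
  also have "\<dots> \<le> (\<Sum>i\<in>L. card (forests V (L - {i})) * 2 ^ (n - 1))"
    by (intro sum_mono mult_right_mono forests_ge) auto
  also have "\<dots> = (\<Sum>i\<in>L. card (forests V (L - {i}) \<times> Pow (L - {i})))"
    using assms card_L by (intro sum.cong) (simp_all add: card_cartesian_product card_Pow)
  also have "\<dots> = card (looped_trees V L)"
    unfolding looped_trees_def using assms by (subst card_SigmaI) (auto intro: finite_forests)
  finally show ?thesis .
qed

lemma looped_draw_loop_iff:
  assumes "(i, f, B) \<in> looped_trees V L" "e \<in> L"
  shows "fst (looped_draw V L d (i, f, B) e) = snd (looped_draw V L d (i, f, B) e) \<longleftrightarrow> e = i"
  using assms forests_not_loop[of f V "L - {i}" e]
  by (auto simp: looped_draw_def looped_trees_def)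

text \<open>Decoding goes in stages: the only loop gives \<open>i\<close>, its node gives the root,
  the unordered ends then give the tree by \<open>forest_eqI\<close>, and the order of the ends
  gives \<open>B\<close>.\<close>

lemma inj_on_looped_draw:
  assumes V: "finite V" "finite L" "card V = card L"
  shows "inj_on (looped_draw V L d) (looped_trees V L)"
proof (rule inj_onI)
  fix s t assume s: "s \<in> looped_trees V L" and t: "t \<in> looped_trees V L"
    and eq: "looped_draw V L d s = looped_draw V L d t"
  obtain i f B where s': "s = (i, f, B)" by (metis prod_cases3)
  obtain i' g B' where t': "t = (i', g, B')" by (metis prod_cases3)
  have i: "i \<in> L" "i' = i"
    using looped_draw_loop_iff[of i f B V L i d] looped_draw_loop_iff[of i' g B' V L i d]
      s t s' t' eq by (auto simp: looped_trees_def)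
  let ?E = "L - {i}"
  have f: "f \<in> forests V ?E" "B \<subseteq> ?E" and g: "g \<in> forests V ?E" "B' \<subseteq> ?E"
    using s t s' t' i by (auto simp: looped_trees_def)
  have card: "card V = Suc (card ?E)"
    using V i by (metis card_Suc_Diff1)
  have roots: "forest_root V ?E g = forest_root V ?E f"
    using fun_cong[OF eq, of i] i s' t' by (simp add: looped_draw_def)
  have draw: "(if e \<in> B then prod.swap (f e) else f e) = (if e \<in> B' then prod.swap (g e) else g e)"
    if "e \<in> ?E" for e
    using fun_cong[OF eq, of e] that i s' t' by (simp add: looped_draw_def)
  have "f = g"
  proof (rule forest_eqI[OF f(1) g(1)])
    show "(fst \<circ> f) ` ?E = V - {forest_root V ?E f}"
      using f(1) V(1) card by (rule forest_root)
    show "(fst \<circ> g) ` ?E = V - {forest_root V ?E f}"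
      unfolding roots[symmetric] using g(1) V(1) card by (rule forest_root)
    show "{fst (f e), snd (f e)} = {fst (g e), snd (g e)}" if "e \<in> ?E" for e
      using draw[OF that] by (cases "f e"; cases "g e") (auto split: if_splits)
  qed (use V in auto)
  moreover have "e \<in> B \<longleftrightarrow> e \<in> B'" if "e \<in> ?E" for e
    using draw[OF that] forests_not_loop[OF f(1) that] \<open>f = g\<close>
    by (cases "f e") (auto split: if_splits)
  then have "B = B'"
    using f(2) g(2) by blast
  ultimately show "s = t"
    using s' t' i by simp
qed

lemma looped_draw_in_PiE_dflt:
  assumes V: "finite V" "finite L" "card V = card L" and t: "t \<in> looped_trees V L"
  shows "looped_draw V L d t \<in> PiE_dflt L d (\<lambda>_. V \<times> V)"
proof -
  obtain i f B where t': "t = (i, f, B)" by (metis prod_cases3)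
  have i: "i \<in> L" and f: "f \<in> forests V (L - {i})"
    using t t' by (auto simp: looped_trees_def)
  have "card V = Suc (card (L - {i}))"
    using V i by (metis card_Suc_Diff1)
  then have "forest_root V (L - {i}) f \<in> V"
    using f V(1) by (intro forest_root)
  then show ?thesis
    using forests_in_verts[OF f]
    by (auto simp: PiE_dflt_def looped_draw_def t' mem_Times_iff)
qed

text \<open>Reversals in \<open>B\<close> do not change the sets of end points, so the graph is the
  tree with a loop at its root.\<close>

lemma pseudotree_looped_draw:
  assumes "t \<in> looped_trees {1..n} {1..n}"
  shows "pseudotree (multigraph_of_pairs n (looped_draw {1..n} {1..n} d t))"
proof -
  obtain i f B where t': "t = (i, f, B)" by (metis prod_cases3)
  have i: "i \<in> {1..n}" and f: "f \<in> forests {1..n} ({1..n} - {i})"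
    using assms t' by (auto simp: looped_trees_def)
  have card: "card {1..n} = Suc (card ({1..n} - {i}))"
    using i by (metis card_Suc_Diff1 finite_atLeastAtMost)
  show ?thesis
    by (rule pseudotree_tree_with_loop[OF f _ forest_root[OF f _ card], where i = i])
      (use i in \<open>auto simp: multigraph_of_pairs_def looped_draw_def t'\<close>)
qed

section \<open>From the count to the probability\<close>

lemma prob_pseudotree_ge:
  assumes "n \<ge> 1"
  shows "measure_pmf.prob (random_multigraph n) {G. pseudotree G} \<ge>
    fact n * real n ^ (n - 1) * 2 ^ (n - 1) / (real n ^ 2) ^ n"
proof -
  let ?V = "{1..n}" and ?d = "(0, 0) :: nat \<times> nat"
  let ?S = "PiE_dflt ?V ?d (\<lambda>_. ?V \<times> ?V)"
  let ?X = "{\<omega>. pseudotree (multigraph_of_pairs n \<omega>)}"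
  have S: "finite ?S" "?S \<noteq> {}" "card ?S = (n ^ 2) ^ n"
    using assms by (auto simp: card_PiE_dflt power2_eq_square)
  have "fact n * n ^ (n - 1) * 2 ^ (n - 1) \<le> card (looped_trees ?V ?V)"
    using assms by (intro card_looped_trees_ge) auto
  also have "\<dots> \<le> card (?S \<inter> ?X)"
  proof (rule card_inj_on_le)
    show "inj_on (looped_draw ?V ?V ?d) (looped_trees ?V ?V)"
      by (rule inj_on_looped_draw) auto
    show "looped_draw ?V ?V ?d ` looped_trees ?V ?V \<subseteq> ?S \<inter> ?X"
      using looped_draw_in_PiE_dflt[of ?V ?V _ ?d] pseudotree_looped_draw by blast
  qed (use S(1) in simp)
  finally have "real (fact n * n ^ (n - 1) * 2 ^ (n - 1)) \<le> card (?S \<inter> ?X)"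
    by (simp only: of_nat_le_iff)
  \<comment> \<open>A product of uniform distributions is uniform on the product set, so the
    probability is a quotient of cardinalities.\<close>
  moreover have "measure_pmf.prob (random_multigraph n) {G. pseudotree G} =
      card (?S \<inter> ?X) / card ?S"
    unfolding random_multigraph_def measure_map_pmf using assms S
    by (subst Pi_pmf_of_set) (auto simp: measure_pmf_of_set vimage_def)
  ultimately show ?thesis
    using S(3) by (simp add: divide_right_mono)
qed

theorem theorem5p1:
  fixes n :: nat
  assumes "n \<ge> 1"
  shows "measure_pmf.prob (random_multigraph n) {G. pseudotree G}
           \<ge> (exp 1 / 2) powr (- real n) * sqrt (pi / (2 * real n))"
proof -
  have n: "real n > 0"
    using assms by simp
  obtain m where m: "n = Suc m"
    using assms by (cases n) auto
  \<comment> \<open>The factor \<open>2 * n\<close> split off here raises both exponents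
    \<open>n - 1\<close> in the count to \<open>n\<close>.\<close>
  have "sqrt (2 * pi * n) = sqrt ((2 * real n) ^ 2 * (pi / (2 * n)))"
    using n by (intro arg_cong[where f = sqrt]) (simp add: field_simps power2_eq_square)
  also have "\<dots> = 2 * n * sqrt (pi / (2 * n))"
    by (simp only: real_sqrt_mult real_sqrt_abs)
  finally have sqrt_eq: "sqrt (2 * pi * n) = 2 * n * sqrt (pi / (2 * n))" .
  have "(exp 1 / 2) powr (- real n) * sqrt (pi / (2 * real n)) =
      sqrt (2 * pi * n) * (n / exp 1) ^ n * real n ^ (n - 1) * 2 ^ (n - 1) / (real n ^ 2) ^ n"
  proof -
    have "(exp 1 / 2) powr (- real n) = 2 ^ n / exp 1 ^ n"
      by (simp add: powr_minus powr_realpow power_divide)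
    moreover have "real n ^ n = n * real n ^ (n - 1)" "2 ^ n = 2 * (2::real) ^ (n - 1)"
      using m by simp_all
    ultimately show ?thesis
      unfolding sqrt_eq using n
      by (simp add: power_divide power2_eq_square power_mult_distrib divide_simps)
  qed
  also have "\<dots> \<le> fact n * real n ^ (n - 1) * 2 ^ (n - 1) / (real n ^ 2) ^ n"
    using fact_ge_stirling[OF assms] by (intro divide_right_mono mult_right_mono) auto
  also have "\<dots> \<le> measure_pmf.prob (random_multigraph n) {G. pseudotree G}"
    using prob_pseudotree_ge[OF assms] .
  finally show ?thesis .
qed

end
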